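(* The algebra $U(\mathbb{M})$ is not power-associative; that is, it is not true that every element of $U(\mathbb{M})$ generates an associative subalgebra.
   Context: Let $\mathbb{F}$ be a field of characteristic $\ne 2,3$. $\mathbb{M}$ is the 5-dimensional nilpotent (non-Lie) Malcev algebra over $\mathbb{F}$ with basis $a,b,c,d,e$ and anticommutative product determined by $[a,b]=c$, $[c,d]=e$ (so $[b,a]=-c$, $[d,c]=-e$), all other products of basis elements being $0$. The universal nonassociative enveloping algebra is $U(\mathbb{M})=F(\mathbb{M})/R(\mathbb{M})$, where $F(\mathbb{M})$ is the unital free nonassociative $\mathbb{F}$-algebra on $\{a,b,c,d,e\}$ (with $\mathbb{M}$ viewed as the span of the generators) and $R(\mathbb{M})$ is the two-sided ideal generated by $fg-gf-[f,g]$, $(f,x,y)+(x,f,y)$, $(x,f,y)+(x,y,f)$ for all $f,g\in\mathbb{M}$, $x,y\in F(\mathbb{M})$; here $(x,y,z)=(xy)z-x(yz)$. By a theorem of Pérez-Izquierdo and Shestakov, $\mathbb{M}\to U(\mathbb{M})$ is injective and $U(\mathbb{M})$ has as a basis the left-tapped monomials $x_1(x_2(\cdots(x_{n-1}x_n)\cdots))$ with $n\ge 0$, $x_1\le\cdots\le x_n$ in the order $a<b<c<d<e$ (the empty monomial being $1$). *)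

theory Defs
  imports
    "HOL-Computational_Algebra.Computational_Algebra"
    "HOL-Library.Poly_Mapping"
begin

section \<open>Nonassociative algebras over a field\<close>

locale nonassoc_algebra = vector_space scale
  for scale :: "'a::field \<Rightarrow> 'b::ab_group_add \<Rightarrow> 'b" +
  fixes mult :: "'b \<Rightarrow> 'b \<Rightarrow> 'b"
  assumes mult_add_left: "mult (x + y) z = mult x z + mult y z"
    and mult_add_right: "mult x (y + z) = mult x y + mult x z"
    and mult_scale_left: "mult (scale r x) y = scale r (mult x y)"
    and mult_scale_right: "mult x (scale r y) = scale r (mult x y)"
begin

definition associator :: "'b \<Rightarrow> 'b \<Rightarrow> 'b \<Rightarrow> 'b" where
  "associator x y z = mult (mult x y) z - mult x (mult y z)"

text \<open>Subalgebras need not contain a unit. For a unital algebra this does not affect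
  power-associativity, since adjoining the unit to a subalgebra preserves associativity.\<close>

definition subalgebra :: "'b set \<Rightarrow> bool" where
  "subalgebra S \<longleftrightarrow> subspace S \<and> (\<forall>x\<in>S. \<forall>y\<in>S. mult x y \<in> S)"

definition two_sided_ideal :: "'b set \<Rightarrow> bool" where
  "two_sided_ideal I \<longleftrightarrow> subspace I \<and> (\<forall>x\<in>I. \<forall>y. mult x y \<in> I \<and> mult y x \<in> I)"

definition associative_on :: "'b set \<Rightarrow> bool" where
  "associative_on S \<longleftrightarrow> (\<forall>x\<in>S. \<forall>y\<in>S. \<forall>z\<in>S. mult (mult x y) z = mult x (mult y z))"

definition power_associative :: bool where
  "power_associative \<longleftrightarrow> (\<forall>u. associative_on (subalgebra hull {u}))"

lemma mult_zero_left: "mult 0 y = 0"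
  using mult_scale_left[of 0 0 y] by simp

lemma mult_zero_right: "mult x 0 = 0"
  using mult_scale_right[of x 0 0] by simp

lemma mult_diff_left: "mult (x - y) z = mult x z - mult y z"
  by (metis add_diff_cancel diff_add_cancel mult_add_left)

lemma mult_diff_right: "mult x (y - z) = mult x y - mult x z"
  by (metis add_diff_cancel diff_add_cancel mult_add_right)

lemma subalgebra_hull: "subalgebra (subalgebra hull S)"
proof (rule hull_in)
  fix T assume "Ball T subalgebra"
  then show "subalgebra (\<Inter>T)"
    unfolding subalgebra_def using subspace_Inter[of T] by auto
qed

lemma two_sided_ideal_hull: "two_sided_ideal (two_sided_ideal hull S)"
proof (rule hull_in)
  fix T assume "Ball T two_sided_ideal"
  then show "two_sided_ideal (\<Inter>T)"
    unfolding two_sided_ideal_def using subspace_Inter[of T] by auto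
qed

end

section \<open>Free vector spaces and algebras given by structure constants\<close>

text \<open>The type \<open>'i \<Rightarrow>\<^sub>0 'a\<close> of finitely supported functions is the vector space with basis
  \<open>'i\<close>; the basis vector \<open>i\<close> is \<open>Poly_Mapping.single i 1\<close>.\<close>

definition free_scale :: "'a::field \<Rightarrow> ('i \<Rightarrow>\<^sub>0 'a) \<Rightarrow> ('i \<Rightarrow>\<^sub>0 'a)" where
  "free_scale r f = Poly_Mapping.map ((*) r) f"

definition linear_ext :: "('i \<Rightarrow> ('k \<Rightarrow>\<^sub>0 'a)) \<Rightarrow> ('i \<Rightarrow>\<^sub>0 'a) \<Rightarrow> ('k \<Rightarrow>\<^sub>0 'a::field)" where
  "linear_ext h f = (\<Sum>i\<in>Poly_Mapping.keys f. free_scale (Poly_Mapping.lookup f i) (h i))"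

definition bilinear_ext ::
    "('i \<Rightarrow> 'j \<Rightarrow> ('k \<Rightarrow>\<^sub>0 'a)) \<Rightarrow> ('i \<Rightarrow>\<^sub>0 'a) \<Rightarrow> ('j \<Rightarrow>\<^sub>0 'a) \<Rightarrow> ('k \<Rightarrow>\<^sub>0 'a::field)" where
  "bilinear_ext m f g = linear_ext (\<lambda>i. linear_ext (m i) g) f"

lemma lookup_free_scale [simp]:
  "Poly_Mapping.lookup (free_scale r f) i = r * Poly_Mapping.lookup f i"
  unfolding free_scale_def by (simp add: Poly_Mapping.map.rep_eq when_def)

interpretation free_space: vector_space "free_scale :: 'a::field \<Rightarrow> ('i \<Rightarrow>\<^sub>0 'a) \<Rightarrow> _"
  by unfold_locales (auto intro!: poly_mapping_eqI simp: lookup_add algebra_simps)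

lemma linear_ext_superset:
  assumes "finite S" "Poly_Mapping.keys f \<subseteq> S"
  shows "linear_ext h f = (\<Sum>i\<in>S. free_scale (Poly_Mapping.lookup f i) (h i))"
  unfolding linear_ext_def using assms
  by (intro sum.mono_neutral_left) (auto simp: in_keys_iff)

lemma linear_ext_add: "linear_ext h (f + g) = linear_ext h f + linear_ext h g"
proof -
  let ?S = "Poly_Mapping.keys f \<union> Poly_Mapping.keys g"
  have "finite ?S" by simp
  moreover have "Poly_Mapping.keys (f + g) \<subseteq> ?S" by (rule Poly_Mapping.keys_add)
  ultimately show ?thesis
    by (simp add: linear_ext_superset[of ?S] lookup_add free_space.scale_left_distrib
        sum.distrib)
qed

lemma linear_ext_scale: "linear_ext h (free_scale r f) = free_scale r (linear_ext h f)"
proof -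
  have "Poly_Mapping.keys (free_scale r f) \<subseteq> Poly_Mapping.keys f"
    by (auto simp: in_keys_iff)
  then show ?thesis
    by (simp add: linear_ext_superset[of "Poly_Mapping.keys f"] free_space.scale_sum_right)
qed

lemma linear_ext_single [simp]: "linear_ext h (Poly_Mapping.single i r) = free_scale r (h i)"
  by (simp add: linear_ext_superset[of "{i}"])

lemma linear_ext_fun_add: "linear_ext (\<lambda>i. h i + k i) f = linear_ext h f + linear_ext k f"
  by (simp add: linear_ext_def free_space.scale_right_distrib sum.distrib)

lemma linear_ext_fun_scale: "linear_ext (\<lambda>i. free_scale r (h i)) f = free_scale r (linear_ext h f)"
  by (simp add: linear_ext_def free_space.scale_sum_right mult.commute)

lemma nonassoc_algebra_bilinear_ext:
  fixes m :: "'i \<Rightarrow> 'i \<Rightarrow> ('i \<Rightarrow>\<^sub>0 'a::field)"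
  shows "nonassoc_algebra free_scale (bilinear_ext m)"
  by unfold_locales
    (simp_all add: bilinear_ext_def linear_ext_add linear_ext_scale linear_ext_fun_add
      linear_ext_fun_scale)

section \<open>The Malcev algebra\<close>

datatype gen = Ga | Gb | Gc | Gd | Ge

type_synonym 'a malcev = "gen \<Rightarrow>\<^sub>0 'a"

fun basis_bracket :: "gen \<Rightarrow> gen \<Rightarrow> 'a::field malcev" where
  "basis_bracket Ga Gb = Poly_Mapping.single Gc 1"
| "basis_bracket Gb Ga = - Poly_Mapping.single Gc 1"
| "basis_bracket Gc Gd = Poly_Mapping.single Ge 1"
| "basis_bracket Gd Gc = - Poly_Mapping.single Ge 1"
| "basis_bracket _ _ = 0"

definition bracket :: "'a::field malcev \<Rightarrow> 'a malcev \<Rightarrow> 'a malcev" where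
  "bracket = bilinear_ext basis_bracket"

section \<open>The unital free nonassociative algebra\<close>

text \<open>Nonassociative words are binary trees with labelled leaves; a monomial is a word or the
  empty monomial \<open>None\<close>, which is the unit.\<close>

datatype 'v word = Leaf 'v | Node "'v word" "'v word"

fun mon_mult :: "'v word option \<Rightarrow> 'v word option \<Rightarrow> 'v word option" where
  "mon_mult None t = t"
| "mon_mult s None = s"
| "mon_mult (Some s) (Some t) = Some (Node s t)"

type_synonym 'a free_alg = "gen word option \<Rightarrow>\<^sub>0 'a"

definition free_mult :: "'a::field free_alg \<Rightarrow> 'a free_alg \<Rightarrow> 'a free_alg" where
  "free_mult = bilinear_ext (\<lambda>s t. Poly_Mapping.single (mon_mult s t) 1)"

definition free_one :: "'a::field free_alg" where
  "free_one = Poly_Mapping.single None 1"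

definition embed :: "'a::field malcev \<Rightarrow> 'a free_alg" where
  "embed = linear_ext (\<lambda>i. Poly_Mapping.single (Some (Leaf i)) 1)"

interpretation FA: nonassoc_algebra "free_scale :: 'a::field \<Rightarrow> 'a free_alg \<Rightarrow> 'a free_alg" free_mult
  unfolding free_mult_def by (rule nonassoc_algebra_bilinear_ext)

lemma mon_mult_None_right [simp]: "mon_mult s None = s"
  by (cases s) auto

lemma linear_ext_basis: "linear_ext (\<lambda>i. Poly_Mapping.single i 1) f = f"
proof (rule poly_mapping_eqI)
  fix k
  have "Poly_Mapping.lookup (linear_ext (\<lambda>i. Poly_Mapping.single i 1) f) k
      = (\<Sum>i\<in>insert k (Poly_Mapping.keys f). Poly_Mapping.lookup f i * (1 when i = k))"
    by (subst linear_ext_superset[of "insert k (Poly_Mapping.keys f)"])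
      (auto simp: lookup_sum lookup_single)
  also have "\<dots> = (\<Sum>i\<in>insert k (Poly_Mapping.keys f). if i = k then Poly_Mapping.lookup f i else 0)"
    by (intro sum.cong) (auto simp: when_def)
  also have "\<dots> = Poly_Mapping.lookup f k"
    by (subst sum.delta) auto
  finally show "Poly_Mapping.lookup (linear_ext (\<lambda>i. Poly_Mapping.single i 1) f) k
      = Poly_Mapping.lookup f k" .
qed

lemma free_mult_one_left: "free_mult free_one x = x"
  by (simp add: free_mult_def free_one_def bilinear_ext_def linear_ext_basis)

lemma free_mult_one_right: "free_mult x free_one = x"
  by (simp add: free_mult_def free_one_def bilinear_ext_def linear_ext_basis)

section \<open>The universal nonassociative enveloping algebra\<close>

definition env_relators :: "'a::field free_alg set" where
  "env_relators =
     {free_mult (embed f) (embed g) - free_mult (embed g) (embed f) - embed (bracket f g) | f g. True}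
   \<union> {FA.associator (embed f) x y + FA.associator x (embed f) y | f x y. True}
   \<union> {FA.associator x (embed f) y + FA.associator x y (embed f) | f x y. True}"

definition env_ideal :: "'a::field free_alg set" where
  "env_ideal = FA.two_sided_ideal hull env_relators"

lemma two_sided_ideal_env_ideal: "FA.two_sided_ideal env_ideal"
  unfolding env_ideal_def by (rule FA.two_sided_ideal_hull)

lemma subspace_env_ideal: "free_space.subspace env_ideal"
  by (rule two_sided_ideal_env_ideal[unfolded FA.two_sided_ideal_def, THEN conjunct1])

definition env_rel :: "'a::field free_alg \<Rightarrow> 'a free_alg \<Rightarrow> bool" where
  "env_rel x y \<longleftrightarrow> x - y \<in> env_ideal"

lemma equivp_env_rel: "equivp (env_rel :: 'a::field free_alg \<Rightarrow> _)"
proof (rule equivpI)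
  show "reflp (env_rel :: 'a free_alg \<Rightarrow> _)"
    by (auto intro!: reflpI simp: env_rel_def free_space.subspace_0[OF subspace_env_ideal])
  show "symp (env_rel :: 'a free_alg \<Rightarrow> _)"
    by (rule sympI) (metis env_rel_def free_space.subspace_neg minus_diff_eq subspace_env_ideal)
  show "transp (env_rel :: 'a free_alg \<Rightarrow> _)"
  proof (rule transpI)
    fix x y z :: "'a free_alg" assume "env_rel x y" "env_rel y z"
    then have "(x - y) + (y - z) \<in> env_ideal"
      unfolding env_rel_def by (rule free_space.subspace_add[OF subspace_env_ideal])
    then show "env_rel x z" by (simp add: env_rel_def)
  qed
qed

quotient_type (overloaded) 'a env = "'a::field free_alg" / env_rel
  by (rule equivp_env_rel)

instantiation env :: (field) ab_group_add
begin

lift_definition zero_env :: "'a env" is 0 .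

lift_definition plus_env :: "'a env \<Rightarrow> 'a env \<Rightarrow> 'a env" is "(+)"
  unfolding env_rel_def by (metis add_diff_add free_space.subspace_add subspace_env_ideal)

lift_definition uminus_env :: "'a env \<Rightarrow> 'a env" is uminus
  unfolding env_rel_def
  by (metis free_space.subspace_neg minus_diff_minus subspace_env_ideal)

lift_definition minus_env :: "'a env \<Rightarrow> 'a env \<Rightarrow> 'a env" is "(-)"
proof -
  fix x x' y y' :: "'a free_alg" assume "env_rel x x'" "env_rel y y'"
  then have "(x - x') - (y - y') \<in> env_ideal"
    unfolding env_rel_def by (rule free_space.subspace_diff[OF subspace_env_ideal])
  then show "env_rel (x - y) (x' - y')"
    by (simp add: env_rel_def algebra_simps)
qed

instance
  by standard (transfer; simp add: algebra_simps equivp_reflp[OF equivp_env_rel])+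

end

lift_definition env_scale :: "'a::field \<Rightarrow> 'a env \<Rightarrow> 'a env" is free_scale
  unfolding env_rel_def
  by (metis free_space.scale_right_diff_distrib free_space.subspace_scale subspace_env_ideal)

lift_definition env_mult :: "'a::field env \<Rightarrow> 'a env \<Rightarrow> 'a env" is free_mult
proof -
  fix x x' y y' :: "'a free_alg" assume *: "env_rel x x'" "env_rel y y'"
  have "free_mult (x - x') y \<in> env_ideal" "free_mult x' (y - y') \<in> env_ideal"
    using * two_sided_ideal_env_ideal by (auto simp: env_rel_def FA.two_sided_ideal_def)
  from free_space.subspace_add[OF subspace_env_ideal this]
  show "env_rel (free_mult x y) (free_mult x' y')"
    by (simp add: env_rel_def FA.mult_diff_left FA.mult_diff_right)
qed

lift_definition env_one :: "'a::field env" is free_one .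

interpretation env: nonassoc_algebra "env_scale :: 'a::field \<Rightarrow> 'a env \<Rightarrow> 'a env" env_mult
  by unfold_locales
    (transfer; simp add: equivp_reflp[OF equivp_env_rel] algebra_simps
      free_space.scale_right_distrib free_space.scale_left_distrib
      FA.mult_add_left FA.mult_add_right FA.mult_scale_left FA.mult_scale_right)+

lemma env_mult_one_left: "env_mult env_one x = x"
  by transfer (simp add: free_mult_one_left equivp_reflp[OF equivp_env_rel])

lemma env_mult_one_right: "env_mult x env_one = x"
  by transfer (simp add: free_mult_one_right equivp_reflp[OF equivp_env_rel])

end

theory Submission
  imports Defs "HOL-Library.Product_Plus"
begin

section \<open>Mapping the enveloping algebra to another algebra\<close>

text \<open>U(M) maps to any unital algebra in which the images of the generators satisfy the
  bracket relations and lie in the generalized alternative nucleus; one such target with an element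
  u in the image and (u, u, u) \<noteq> 0 suffices (\<open>free_eval_env_ideal\<close>,
  \<open>env_not_power_associativeI\<close>). The target is W + Wd + We, with W associative and Wd +
  We a square-zero ideal. Its product is twisted by derivations P, Q of W and a map D whose failure
  to be a derivation is P x Q y - Q x P y. For u = a^2 + b^2 + d the associator has only a third
  coordinate, 4c. W is realised as a ring of linear operators in which a, b satisfy the Heisenberg
  relations, P, Q, D are built from commutators (\<open>op_relations\<close>), and c is a shift, so
  that 4c \<noteq> 0 (\<open>four_op_c_nonzero\<close>).\<close>

lemma poly_mapping_in_subspace:
  assumes "free_space.subspace S" and "\<And>i. Poly_Mapping.single i 1 \<in> S"
  shows "f \<in> S"
proof -
  have "(\<Sum>i\<in>Poly_Mapping.keys f. free_scale (Poly_Mapping.lookup f i) (Poly_Mapping.single i 1)) \<in> S"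
    by (intro free_space.subspace_sum free_space.subspace_scale assms)
  then show ?thesis
    by (simp add: linear_ext_basis flip: linear_ext_def)
qed

context nonassoc_algebra
begin

section \<open>Linear maps out of a free vector space\<close>

definition free_lift :: "('i \<Rightarrow> 'b) \<Rightarrow> ('i \<Rightarrow>\<^sub>0 'a) \<Rightarrow> 'b" where
  "free_lift h f = (\<Sum>i\<in>Poly_Mapping.keys f. scale (Poly_Mapping.lookup f i) (h i))"

lemma free_lift_superset:
  assumes "finite S" "Poly_Mapping.keys f \<subseteq> S"
  shows "free_lift h f = (\<Sum>i\<in>S. scale (Poly_Mapping.lookup f i) (h i))"
  unfolding free_lift_def using assms
  by (intro sum.mono_neutral_left) (auto simp: in_keys_iff)

lemma free_lift_add: "free_lift h (f + g) = free_lift h f + free_lift h g"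
proof -
  let ?S = "Poly_Mapping.keys f \<union> Poly_Mapping.keys g"
  have "Poly_Mapping.keys (f + g) \<subseteq> ?S" by (rule Poly_Mapping.keys_add)
  then show ?thesis
    by (simp add: free_lift_superset[of ?S] lookup_add scale_left_distrib sum.distrib)
qed

lemma free_lift_scale: "free_lift h (free_scale r f) = scale r (free_lift h f)"
proof -
  have "Poly_Mapping.keys (free_scale r f) \<subseteq> Poly_Mapping.keys f"
    by (auto simp: in_keys_iff)
  then show ?thesis
    by (simp add: free_lift_superset[of "Poly_Mapping.keys f"] scale_sum_right)
qed

lemma free_lift_single: "free_lift h (Poly_Mapping.single i r) = scale r (h i)"
  by (simp add: free_lift_superset[of "{i}"])

lemma free_lift_zero: "free_lift h 0 = 0"
  by (simp add: free_lift_def)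

lemma free_lift_diff: "free_lift h (f - g) = free_lift h f - free_lift h g"
  by (metis add_diff_cancel diff_add_cancel free_lift_add)

lemma free_lift_minus: "free_lift h (- f) = - free_lift h f"
  by (metis diff_0 free_lift_diff free_lift_zero)

section \<open>Associators and the generalized alternative nucleus\<close>

lemma associator_add:
  "associator (x + x') y z = associator x y z + associator x' y z"
  "associator x (y + y') z = associator x y z + associator x y' z"
  "associator x y (z + z') = associator x y z + associator x y z'"
  by (simp_all add: associator_def mult_add_left mult_add_right)

lemma associator_scale:
  "associator (scale r x) y z = scale r (associator x y z)"
  "associator x (scale r y) z = scale r (associator x y z)"
  "associator x y (scale r z) = scale r (associator x y z)"
  by (simp_all add: associator_def mult_scale_left mult_scale_right scale_right_diff_distrib)

lemma associator_zero: "associator 0 y z = 0" "associator x 0 z = 0" "associator x y 0 = 0"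
  by (simp_all add: associator_def mult_zero_left mult_zero_right)

definition alternative_nucleus :: "'b set" where
  "alternative_nucleus = {f. \<forall>x y. associator f x y + associator x f y = 0 \<and>
     associator x f y + associator x y f = 0}"

text \<open>Because of this, the alternativity relators need checking only at the five
  generators.\<close>

lemma subspace_alternative_nucleus: "subspace alternative_nucleus"
proof (rule subspaceI)
  fix f g assume *: "f \<in> alternative_nucleus" "g \<in> alternative_nucleus"
  have "associator (f + g) x y + associator x (f + g) y
      = (associator f x y + associator x f y) + (associator g x y + associator x g y)"
    "associator x (f + g) y + associator x y (f + g)
      = (associator x f y + associator x y f) + (associator x g y + associator x y g)" for x y
    by (simp_all add: associator_add)
  with * show "f + g \<in> alternative_nucleus"
    by (simp add: alternative_nucleus_def)
next
  fix r f assume "f \<in> alternative_nucleus"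
  then show "scale r f \<in> alternative_nucleus"
    by (simp add: alternative_nucleus_def associator_scale flip: scale_right_distrib)
qed (simp add: alternative_nucleus_def associator_zero)

section \<open>Evaluation of the free algebra and the universal property of U(M)\<close>

primrec word_eval :: "(gen \<Rightarrow> 'b) \<Rightarrow> gen word \<Rightarrow> 'b" where
  "word_eval \<gamma> (Leaf i) = \<gamma> i"
| "word_eval \<gamma> (Node s t) = mult (word_eval \<gamma> s) (word_eval \<gamma> t)"

definition free_eval :: "'b \<Rightarrow> (gen \<Rightarrow> 'b) \<Rightarrow> 'a free_alg \<Rightarrow> 'b" where
  "free_eval u \<gamma> = free_lift (case_option u (word_eval \<gamma>))"

lemma free_eval_mult:
  assumes "\<And>x. mult u x = x" "\<And>x. mult x u = x"
  shows "free_eval u \<gamma> (free_mult x y) = mult (free_eval u \<gamma> x) (free_eval u \<gamma> y)"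
proof -
  let ?\<pi> = "free_eval u \<gamma>"
  note lin = free_eval_def free_lift_add free_lift_scale free_lift_zero free_lift_single
    FA.mult_add_left FA.mult_add_right FA.mult_scale_left FA.mult_scale_right FA.mult_zero_left
    FA.mult_zero_right mult_add_left mult_add_right mult_scale_left mult_scale_right
    mult_zero_left mult_zero_right
  have 1: "?\<pi> (free_mult (Poly_Mapping.single s 1) (Poly_Mapping.single t 1))
      = mult (?\<pi> (Poly_Mapping.single s 1)) (?\<pi> (Poly_Mapping.single t 1))" for s t
    by (cases s; cases t) (simp_all add: free_mult_def bilinear_ext_def lin assms)
  \<comment> \<open>Both sides are linear in each argument, so the solutions form a subspace;
    containing the basis, it is everything.\<close>
  have "y \<in> {y. ?\<pi> (free_mult (Poly_Mapping.single s 1) y)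
      = mult (?\<pi> (Poly_Mapping.single s 1)) (?\<pi> y)}" for s y
    by (rule poly_mapping_in_subspace) (auto intro!: free_space.subspaceI simp: 1, auto simp: lin)
  then have 2: "?\<pi> (free_mult (Poly_Mapping.single s 1) y)
      = mult (?\<pi> (Poly_Mapping.single s 1)) (?\<pi> y)" for s y
    by simp
  have "x \<in> {x. ?\<pi> (free_mult x y) = mult (?\<pi> x) (?\<pi> y)}"
    by (rule poly_mapping_in_subspace) (auto intro!: free_space.subspaceI simp: 2, auto simp: lin)
  then show ?thesis by simp
qed

lemma free_eval_diff: "free_eval u \<gamma> (x - y) = free_eval u \<gamma> x - free_eval u \<gamma> y"
  by (simp add: free_eval_def free_lift_diff)

lemma free_eval_associator:
  assumes "\<And>x. mult u x = x" "\<And>x. mult x u = x"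
  shows "free_eval u \<gamma> (FA.associator x y z)
    = associator (free_eval u \<gamma> x) (free_eval u \<gamma> y) (free_eval u \<gamma> z)"
  by (simp add: FA.associator_def associator_def free_eval_diff free_eval_mult[of u, OF assms])

lemma free_eval_embed: "free_eval u \<gamma> (embed f) = free_lift \<gamma> f"
proof -
  have "f \<in> {f. free_eval u \<gamma> (embed f) = free_lift \<gamma> f}"
    by (rule poly_mapping_in_subspace)
      (auto intro!: free_space.subspaceI simp: embed_def free_eval_def free_lift_add
        free_lift_scale free_lift_zero free_lift_single linear_ext_add linear_ext_scale,
       simp add: linear_ext_def free_lift_zero)
  then show ?thesis by simp
qed

lemma free_lift_bracket:
  assumes "\<And>i j. mult (\<gamma> i) (\<gamma> j) - mult (\<gamma> j) (\<gamma> i) = free_lift \<gamma> (basis_bracket i j)"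
  shows "free_lift \<gamma> (bracket f g)
    = mult (free_lift \<gamma> f) (free_lift \<gamma> g) - mult (free_lift \<gamma> g) (free_lift \<gamma> f)"
proof -
  interpret B: nonassoc_algebra free_scale "bracket :: 'a malcev \<Rightarrow> _"
    unfolding bracket_def by (rule nonassoc_algebra_bilinear_ext)
  let ?K = "\<lambda>f g. mult (free_lift \<gamma> f) (free_lift \<gamma> g) - mult (free_lift \<gamma> g) (free_lift \<gamma> f)"
  note lin = free_lift_add free_lift_scale free_lift_zero
    B.mult_add_left B.mult_add_right B.mult_scale_left B.mult_scale_right B.mult_zero_left
    B.mult_zero_right mult_add_left mult_add_right mult_scale_left mult_scale_right
    mult_zero_left mult_zero_right scale_right_diff_distrib
  have 1: "free_lift \<gamma> (bracket (Poly_Mapping.single i 1) (Poly_Mapping.single j 1))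
      = ?K (Poly_Mapping.single i 1) (Poly_Mapping.single j 1)" for i j
    by (simp add: bracket_def bilinear_ext_def free_lift_single assms)
  have "g \<in> {g. free_lift \<gamma> (bracket (Poly_Mapping.single i 1) g)
      = ?K (Poly_Mapping.single i 1) g}" for i g
    by (rule poly_mapping_in_subspace) (auto intro!: free_space.subspaceI simp: 1, auto simp: lin)
  then have 2: "free_lift \<gamma> (bracket (Poly_Mapping.single i 1) g)
      = ?K (Poly_Mapping.single i 1) g" for i g
    by simp
  have "f \<in> {f. free_lift \<gamma> (bracket f g) = ?K f g}"
    by (rule poly_mapping_in_subspace) (auto intro!: free_space.subspaceI simp: 2, auto simp: lin)
  then show ?thesis by simp
qed

text \<open>The kernel of the evaluation homomorphism is a two-sided ideal containing the relators,
  hence the ideal they generate: evaluation factors through U(M).\<close>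

lemma free_eval_env_ideal:
  assumes unit: "\<And>x. mult u x = x" "\<And>x. mult x u = x"
    and bracket: "\<And>i j. mult (\<gamma> i) (\<gamma> j) - mult (\<gamma> j) (\<gamma> i) = free_lift \<gamma> (basis_bracket i j)"
    and nucleus: "\<And>i. \<gamma> i \<in> alternative_nucleus"
    and x: "x \<in> env_ideal"
  shows "free_eval u \<gamma> x = 0"
proof -
  let ?\<pi> = "free_eval u \<gamma>"
  note lin = free_eval_def free_lift_add free_lift_scale free_lift_zero
  note hom = free_eval_mult[of u, OF unit]
  have add: "?\<pi> (x + y) = ?\<pi> x + ?\<pi> y" for x y
    by (simp add: lin)
  have emb: "?\<pi> (embed f) \<in> alternative_nucleus" for f
    unfolding free_eval_embed free_lift_def
    by (intro subspace_sum subspace_scale subspace_alternative_nucleus nucleus)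
  have "FA.two_sided_ideal {x. ?\<pi> x = 0}"
    unfolding FA.two_sided_ideal_def
    by (auto intro!: free_space.subspaceI simp: hom mult_zero_left mult_zero_right, auto simp: lin)
  moreover have "env_relators \<subseteq> {x. ?\<pi> x = 0}"
    using emb
    by (auto simp: env_relators_def add free_eval_diff hom free_eval_associator[of u, OF unit]
        alternative_nucleus_def free_eval_embed free_lift_bracket[OF bracket])
  ultimately have "env_ideal \<subseteq> {x. ?\<pi> x = 0}"
    unfolding env_ideal_def by (rule hull_minimal[rotated])
  with x show ?thesis by blast
qed

text \<open>Power-associativity would put (w, w, w) into \<open>env_ideal\<close>, which evaluation
  sends to 0.\<close>

lemma env_not_power_associativeI:
  assumes unit: "\<And>x. mult u x = x" "\<And>x. mult x u = x"
    and bracket: "\<And>i j. mult (\<gamma> i) (\<gamma> j) - mult (\<gamma> j) (\<gamma> i) = free_lift \<gamma> (basis_bracket i j)"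
    and nucleus: "\<And>i. \<gamma> i \<in> alternative_nucleus"
    and w: "associator (free_eval u \<gamma> w) (free_eval u \<gamma> w) (free_eval u \<gamma> w) \<noteq> 0"
  shows "\<not> nonassoc_algebra.power_associative (env_scale :: 'a \<Rightarrow> 'a env \<Rightarrow> 'a env) env_mult"
proof
  assume pa: "nonassoc_algebra.power_associative (env_scale :: 'a \<Rightarrow> 'a env \<Rightarrow> 'a env) env_mult"
  define U where "U = abs_env w"
  have "U \<in> env.subalgebra hull {U}"
    by (rule hull_inc) simp
  then have "env_mult (env_mult U U) U = env_mult U (env_mult U U)"
    using pa unfolding env.power_associative_def env.associative_on_def by blast
  then have "FA.associator w w w \<in> env_ideal"
    by (simp add: U_def env_mult.abs_eq env.abs_eq_iff env_rel_def FA.associator_def)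
  then have "free_eval u \<gamma> (FA.associator w w w) = 0"
    by (rule free_eval_env_ideal[OF unit bracket nucleus])
  with w show False
    by (simp add: free_eval_associator[of u, OF unit])
qed

end

section \<open>A null extension of an associative algebra\<close>

text \<open>In \<open>U(M)\<close> the elements \<open>a, b\<close> generate an associative subalgebra \<open>W\<close>, the enveloping
  algebra of the Heisenberg Lie algebra, and modulo terms of degree \<open>\<ge> 2\<close> in \<open>d\<close>, where \<open>e\<close> has degree 1, the algebra is
  \<open>W \<oplus> Wd \<oplus> We\<close>. The triple \<open>(x, y, z)\<close> stands for \<open>x + y d + z e/6\<close>; the factor 6 clears all
  denominators. Writing \<open>[x, d] = D(x) e / 2\<close> and \<open>(x, y, d) = B(x, y) e / 6\<close>, the alternativity of
  \<open>d\<close> forces \<open>B(x, y) = D(xy) - x D(y) - D(x) y\<close>, and that of \<open>a\<close> and \<open>b\<close> that \<open>B(-, a)\<close> and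
  \<open>B(-, b)\<close> are derivations; these are \<open>-Q\<close> and \<open>P\<close>, where \<open>P, Q\<close> are the partial derivatives with
  respect to \<open>a, b\<close>. For \<open>u = v + d\<close> with \<open>v = a\<^sup>2 + b\<^sup>2\<close> this gives
  \<open>(u, u, u) = B(v, v) e / 6 = [2a, 2b] e / 6 = 4ce / 6\<close>.\<close>

locale heisenberg_calculus = vector_space scale
  for scale :: "'a::field \<Rightarrow> 'w::ring_1 \<Rightarrow> 'w" +
  fixes P Q D :: "'w \<Rightarrow> 'w" and a b :: 'w
  assumes scale_times_left: "scale r x * y = scale r (x * y)"
    and scale_times_right: "x * scale r y = scale r (x * y)"
    and P_add: "P (x + y) = P x + P y" and P_scale: "P (scale r x) = scale r (P x)"
    and Q_add: "Q (x + y) = Q x + Q y" and Q_scale: "Q (scale r x) = scale r (Q x)"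
    and D_add: "D (x + y) = D x + D y" and D_scale: "D (scale r x) = scale r (D x)"
    and P_times: "P (x * y) = P x * y + x * P y"
    and Q_times: "Q (x * y) = Q x * y + x * Q y"
    and D_times: "D (x * y) = D x * y + x * D y + (P x * Q y - Q x * P y)"
    and P_gens: "P a = 1" "P b = 0"
    and Q_gens: "Q a = 0" "Q b = 1"
    and D_gens: "D a = 0" "D b = 0"
    and commutator_commutes: "(a * b - b * a) * a = a * (a * b - b * a)"
      "(a * b - b * a) * b = b * (a * b - b * a)"
begin

abbreviation "c \<equiv> a * b - b * a"

lemma derivation_simps:
  "P 0 = 0" "Q 0 = 0" "D 0 = 0" "P 1 = 0" "Q 1 = 0" "D 1 = 0"
  "P (x - y) = P x - P y" "Q (x - y) = Q x - Q y" "D (x - y) = D x - D y"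
proof -
  show [simp]: "P 0 = 0" "Q 0 = 0" "D 0 = 0"
    using P_add[of 0 0] Q_add[of 0 0] D_add[of 0 0] by simp_all
  show [simp]: "P 1 = 0" "Q 1 = 0"
    using P_times[of 1 1] Q_times[of 1 1] by simp_all
  show "D 1 = 0"
    using D_times[of 1 1] by simp
  show "P (x - y) = P x - P y" "Q (x - y) = Q x - Q y" "D (x - y) = D x - D y"
    by (metis P_add Q_add D_add add_diff_cancel diff_add_cancel)+
qed

section \<open>The algebra of triples\<close>

definition B :: "'w \<Rightarrow> 'w \<Rightarrow> 'w" where
  "B x y = P x * Q y - Q x * P y"

definition triple_scale :: "'a \<Rightarrow> 'w \<times> 'w \<times> 'w \<Rightarrow> 'w \<times> 'w \<times> 'w" where
  "triple_scale r = (\<lambda>(x, y, z). (scale r x, scale r y, scale r z))"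

text \<open>The correction terms come from x(y'd) = (xy')d - (x, y', d) and, since (y, d, x') = -(y,
  x', d), from (yd)x' = y(x'd) - y[x', d] - (y, x', d) = (yx')d - y[x', d] - 2(y, x', d).\<close>

definition triple_mult :: "'w \<times> 'w \<times> 'w \<Rightarrow> 'w \<times> 'w \<times> 'w \<Rightarrow> 'w \<times> 'w \<times> 'w" where
  "triple_mult = (\<lambda>(x, y, z) (x', y', z').
     (x * x', x * y' + y * x', x * z' + z * x' - B x y' - 3 * (y * D x') - 2 * B y x'))"

sublocale triple: nonassoc_algebra triple_scale triple_mult
  by unfold_locales
    (auto simp: triple_scale_def triple_mult_def B_def P_add Q_add D_add P_scale Q_scale D_scale
      scale_times_left scale_times_right scale_right_distrib scale_left_distrib
      scale_right_diff_distrib distrib_left distrib_right algebra_simps)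

lemma numeral_commutes: "x * numeral n = numeral n * (x::'w)"
  by (metis mult_of_nat_commute of_nat_numeral)

lemma numeral_commutes_left: "x * (numeral n * y) = numeral n * (x * (y::'w))"
  by (metis mult.assoc numeral_commutes)

lemma numeral_expand:
  "2 * x = x + (x::'w)" "3 * x = x + x + (x::'w)" "4 * x = x + x + x + (x::'w)"
  by (simp_all only: numeral.simps distrib_right mult_1_left add.assoc)

lemma triple_mult_simp:
  "triple_mult (x, y, z) (x', y', z') = (x * x', x * y' + y * x',
     x * z' + z * x' - B x y' - 3 * (y * D x') - 2 * B y x')"
  by (simp add: triple_mult_def)

lemmas triple_simps = triple.alternative_nucleus_def triple.associator_def triple_mult_simp
  triple_scale_def B_def zero_prod_def P_add Q_add D_add derivation_simps P_times Q_times D_times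
  P_gens Q_gens D_gens

text \<open>The third coordinates of (x, x', yd), (x, yd, x') and (yd, x, x') are B(x, x')y, -(P x y
  Q x' - Q x y P x') and yB(x, x'). If P and Q are 0 or 1 at one of x, x', as at a, b, c, these
  alternate in that argument; for y = 1 they alternate in d.\<close>

lemma a_nucleus: "(a, 0, 0) \<in> triple.alternative_nucleus"
  by (auto simp: triple_simps algebra_simps numeral_commutes numeral_commutes_left numeral_expand)

lemma b_nucleus: "(b, 0, 0) \<in> triple.alternative_nucleus"
  by (auto simp: triple_simps algebra_simps numeral_commutes numeral_commutes_left numeral_expand)

lemma c_nucleus: "(c, 0, 0) \<in> triple.alternative_nucleus"
  by (auto simp: triple_simps algebra_simps numeral_commutes numeral_commutes_left numeral_expand)

lemma d_nucleus: "(0, 1, 0) \<in> triple.alternative_nucleus"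
  by (auto simp: triple_simps algebra_simps numeral_commutes numeral_commutes_left numeral_expand)

lemma e_nucleus: "(0, 0, 6) \<in> triple.alternative_nucleus"
  by (auto simp: triple_simps algebra_simps numeral_commutes numeral_commutes_left numeral_expand)

primrec gen_image :: "gen \<Rightarrow> 'w \<times> 'w \<times> 'w" where
  "gen_image Ga = (a, 0, 0)"
| "gen_image Gb = (b, 0, 0)"
| "gen_image Gc = (c, 0, 0)"
| "gen_image Gd = (0, 1, 0)"
| "gen_image Ge = (0, 0, 6)"

lemma gen_image_nucleus: "gen_image i \<in> triple.alternative_nucleus"
  by (cases i) (simp_all add: a_nucleus b_nucleus c_nucleus d_nucleus e_nucleus)

text \<open>Here [c, d] has third coordinate 3 D c = 6, because D c = B(a, b) - B(b, a) = 2; D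
  vanishes at a and b, so they commute with d.\<close>

lemma gen_image_bracket:
  "triple_mult (gen_image i) (gen_image j) - triple_mult (gen_image j) (gen_image i)
    = triple.free_lift gen_image (basis_bracket i j)"
  by (cases i; cases j)
    (simp_all add: triple_simps triple.free_lift_zero triple.free_lift_single triple.free_lift_minus
      commutator_commutes numeral_commutes[of a] numeral_commutes[of b]
      numeral_commutes[of "a * b"] numeral_commutes[of "b * a"])

theorem env_not_power_associative:
  assumes "4 * c \<noteq> 0"
  shows "\<not> nonassoc_algebra.power_associative (env_scale :: 'a \<Rightarrow> 'a env \<Rightarrow> 'a env) env_mult"
proof (rule triple.env_not_power_associativeI)
  fix x
  show "triple_mult (1, 0, 0) x = x" "triple_mult x (1, 0, 0) = x"
    by (cases x; simp add: triple_simps)+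
next
  let ?w = "Poly_Mapping.single (Some (Node (Leaf Ga) (Leaf Ga))) 1
    + Poly_Mapping.single (Some (Node (Leaf Gb) (Leaf Gb))) 1
    + Poly_Mapping.single (Some (Leaf Gd)) 1"
  let ?v = "triple.free_eval (1, 0, 0) gen_image ?w"
  have v: "?v = (a * a + b * b, 1, 0)"
    by (simp add: triple.free_eval_def triple.free_lift_add triple.free_lift_single triple_simps)
  have "triple.associator ?v ?v ?v = (0, 0, 4 * c)"
    unfolding v by (simp add: triple_simps algebra_simps numeral_expand)
  with assms show "triple.associator ?v ?v ?v \<noteq> 0"
    by (simp add: zero_prod_def)
qed (rule gen_image_bracket gen_image_nucleus)+

end

section \<open>Operators on doubly infinite sequences\<close>

text \<open>Integer indices make the variable z invertible, as p = -y/z requires. In the ring of all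
  linear operators, P, Q, D can be written as commutator expressions, which gives the product rules
  on the whole ring.\<close>

typedef (overloaded) 'a seq_op =
  "{T :: (int \<times> int \<Rightarrow> 'a::field) \<Rightarrow> int \<times> int \<Rightarrow> 'a.
     (\<forall>f g. T (\<lambda>i. f i + g i) = (\<lambda>i. T f i + T g i)) \<and>
     (\<forall>r f. T (\<lambda>i. r * f i) = (\<lambda>i. r * T f i))}"
  by (rule exI[of _ "\<lambda>f. f"]) simp

setup_lifting type_definition_seq_op

lemma seq_op_diff:
  assumes "\<And>f g. T (\<lambda>i. f i + g i) = (\<lambda>i. T f i + T g i)"
  shows "T (\<lambda>i. f i - g i :: 'a::field) = (\<lambda>i. T f i - T g i :: 'a)"
  using assms[of "\<lambda>i. f i - g i" g] by (simp add: fun_eq_iff)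

instantiation seq_op :: (field) ring_1
begin

lift_definition zero_seq_op :: "'a seq_op" is "\<lambda>f i. 0" by simp
lift_definition one_seq_op :: "'a seq_op" is "\<lambda>f. f" by simp
lift_definition plus_seq_op :: "'a seq_op \<Rightarrow> 'a seq_op \<Rightarrow> 'a seq_op" is
  "\<lambda>S T f i. S f i + T f i" by (simp add: algebra_simps)
lift_definition minus_seq_op :: "'a seq_op \<Rightarrow> 'a seq_op \<Rightarrow> 'a seq_op" is
  "\<lambda>S T f i. S f i - T f i" by (simp add: algebra_simps)
lift_definition uminus_seq_op :: "'a seq_op \<Rightarrow> 'a seq_op" is
  "\<lambda>T f i. - T f i" by (simp add: algebra_simps)
lift_definition times_seq_op :: "'a seq_op \<Rightarrow> 'a seq_op \<Rightarrow> 'a seq_op" is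
  "\<lambda>S T f. S (T f)" by simp

instance
proof
  show "(0 :: 'a seq_op) \<noteq> 1"
    by transfer (auto simp: fun_eq_iff intro!: exI[of _ "\<lambda>_. 1"])
qed (transfer; simp add: fun_eq_iff algebra_simps seq_op_diff)+

end

lift_definition seq_scale :: "'a::field \<Rightarrow> 'a seq_op \<Rightarrow> 'a seq_op" is
  "\<lambda>r T f i. r * T f i" by (simp add: algebra_simps)

text \<open>A sequence \<open>f\<close> stands for the formal series \<open>\<Sum> f(n, k) y\<^sup>n z\<^sup>k\<close>.
  Below, \<open>a = z \<partial>/\<partial>y\<close> and \<open>b = y\<close>, so that \<open>[a, b] = z\<close>; further \<open>p = -y/z\<close>, \<open>q = \<partial>/\<partial>y\<close> and
  \<open>r = 2 \<partial>/\<partial>z + (y/z) \<partial>/\<partial>y\<close>.\<close>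

lift_definition op_a :: "'a::field seq_op" is "\<lambda>f (n, k). of_int (n + 1) * f (n + 1, k - 1)"
  by (auto simp: fun_eq_iff algebra_simps)
lift_definition op_b :: "'a::field seq_op" is "\<lambda>f (n, k). f (n - 1, k)"
  by (auto simp: fun_eq_iff)
lift_definition op_c :: "'a::field seq_op" is "\<lambda>f (n, k). f (n, k - 1)"
  by (auto simp: fun_eq_iff)
lift_definition op_p :: "'a::field seq_op" is "\<lambda>f (n, k). - f (n - 1, k + 1)"
  by (auto simp: fun_eq_iff)
lift_definition op_q :: "'a::field seq_op" is "\<lambda>f (n, k). of_int (n + 1) * f (n + 1, k)"
  by (auto simp: fun_eq_iff algebra_simps)
lift_definition op_r :: "'a::field seq_op" is "\<lambda>f (n, k). of_int (2 * k + 2 + n) * f (n, k + 1)"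
  by (auto simp: fun_eq_iff algebra_simps)

text \<open>Commutation with p and q takes the values of the partial derivatives at a, b. The values
  q and -p of [r, -] at a, b cancel those of p Q x - q P x.\<close>

lemma op_relations:
  "op_a * op_b - op_b * op_a = op_c" "op_c * op_a = op_a * op_c" "op_c * op_b = op_b * op_c"
  "op_p * op_a = op_a * op_p + 1" "op_p * op_b = op_b * op_p"
  "op_q * op_a = op_a * op_q" "op_q * op_b = op_b * op_q + 1"
  "op_r * op_a = op_a * op_r + op_q" "op_r * op_b = op_b * op_r - op_p"
  by (transfer; auto simp: fun_eq_iff algebra_simps)+

text \<open>For inner derivations \<open>P = [p, -]\<close> and \<open>Q = [q, -]\<close> the cocycle \<open>P x Q y - Q x P y\<close> is the
  coboundary of \<open>p Q x - q P x\<close>; adding \<open>[r, -]\<close> makes this vanish at \<open>a\<close> and \<open>b\<close>.\<close>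

interpretation seq_op: heisenberg_calculus "seq_scale :: 'a::field \<Rightarrow> _"
  "\<lambda>x. op_p * x - x * op_p" "\<lambda>x. op_q * x - x * op_q"
  "\<lambda>x. op_r * x - x * op_r + op_p * (op_q * x - x * op_q) - op_q * (op_p * x - x * op_p)"
  op_a op_b
proof unfold_locales
  fix r s :: 'a and x y :: "'a seq_op"
  show "seq_scale r (x + y) = seq_scale r x + seq_scale r y"
    "seq_scale (r + s) x = seq_scale r x + seq_scale s x"
    "seq_scale r (seq_scale s x) = seq_scale (r * s) x" "seq_scale 1 x = x"
    by (transfer; simp add: fun_eq_iff algebra_simps)+
  have scale: "seq_scale r x * y = seq_scale r (x * y)" "x * seq_scale r y = seq_scale r (x * y)"
    "seq_scale r (x + y) = seq_scale r x + seq_scale r y"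
    "seq_scale r (x - y) = seq_scale r x - seq_scale r y" for x y
    by (transfer; simp add: fun_eq_iff algebra_simps)+
  show "seq_scale r x * y = seq_scale r (x * y)" "x * seq_scale r y = seq_scale r (x * y)"
    by (rule scale)+
  show "op_p * seq_scale r x - seq_scale r x * op_p = seq_scale r (op_p * x - x * op_p)"
    "op_q * seq_scale r x - seq_scale r x * op_q = seq_scale r (op_q * x - x * op_q)"
    "op_r * seq_scale r x - seq_scale r x * op_r
       + op_p * (op_q * seq_scale r x - seq_scale r x * op_q)
       - op_q * (op_p * seq_scale r x - seq_scale r x * op_p)
     = seq_scale r (op_r * x - x * op_r + op_p * (op_q * x - x * op_q)
         - op_q * (op_p * x - x * op_p))"
    by (simp_all add: scale right_diff_distrib)
qed ((simp add: algebra_simps; fail) | (simp add: op_relations; fail))+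

section \<open>Nonvanishing of 4c and the conclusion\<close>

lemma four_op_c_nonzero:
  assumes "CHAR('a::field) \<noteq> 2"
  shows "4 * (op_c :: 'a seq_op) \<noteq> 0"
proof
  have "\<not> CHAR('a) dvd 2"
    using assms two_is_prime_nat CHAR_not_1'[where 'a = 'a] by (auto simp: prime_nat_iff)
  then have "(2 :: 'a) \<noteq> 0"
    by (metis of_nat_eq_0_iff_char_dvd of_nat_numeral)
  moreover assume "4 * (op_c :: 'a seq_op) = 0"
  then have "op_c + op_c + op_c + op_c = (0 :: 'a seq_op)"
    by (simp only: seq_op.numeral_expand)
  then have "(4 :: 'a) = 0"
    \<comment> \<open>The shift c fixes the constant array 1, so applying 4c to it leaves 4.\<close>
    by transfer (auto simp: fun_eq_iff dest!: spec[of _ "\<lambda>_. 1"])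
  moreover have "(4 :: 'a) = 2 * 2" by simp
  ultimately show False by (metis mult_eq_0_iff)
qed

theorem mainTheorem2:
  assumes "CHAR('a::field) \<noteq> 2" and "CHAR('a) \<noteq> 3"
  shows "\<not> nonassoc_algebra.power_associative
            (env_scale :: 'a \<Rightarrow> 'a env \<Rightarrow> 'a env) env_mult"
  using four_op_c_nonzero[OF assms(1)]
  by (intro seq_op.env_not_power_associative) (simp add: op_relations)

end
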